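(* Let $\Omega$ be an $I$-graded poset with an up rule $U$ and a down rule $D$, and let $(X_i\in\Omega_i)_{i\in I}$ be a Markov chain. The following are equivalent. (a) $(X_i)_{i\in I}$ is both a $U$-chain and a $D$-chain (and hence $U$ and $D$ are strongly compatible). (b) For any adjacent levels $i,i+1\in I$ it holds that $X_i,X_{i+1},X_i,X_{i+1},\dotsc$ is a $UD$-chain.
   Context: Let $I\subseteq\mathbb{Z}$ be a (possibly infinite) interval of the integers. An $I$-graded poset $\Omega$ is a countable (or finite) poset together with a surjective map $\rho\colon\Omega\to I$ (the rank function) such that $u<v$ implies $\rho(u)<\rho(v)$, and $u\lessdot v$ implies $\rho(v)=\rho(u)+1$. Here $u\lessdot v$ means that $v$ covers $u$, that is, $u<v$ but there is no $w$ with $u<w<v$. The level sets are $\Omega_i=\rho^{-1}(i)$. An up rule on $\Omega$ is an assignment of a probability $U(u\rightarrow v)$ to each pair $(u,v)\in\Omega\times\Omega$ such that $U(u\rightarrow v)>0\Leftrightarrow u\lessdot v$, and $\sum_{v\in\Omega}U(u\rightarrow v)=1$ for any $u$ with non-maximal rank. A down rule is an assignment of a probability $D(u\rightarrow v)$ to each pair such that $D(u\rightarrow v)>0\Leftrightarrow v\lessdot u$, and $\sum_{v\in\Omega}D(u\rightarrow v)=1$ for any $u$ with non-minimal rank. A Markov chain $(X_i\in\Omega_i)_{i\in I}$ is a $U$-chain (with time interval $I$, hence called maximal) if $\mathrm{Prob}(X_i=u\text{ and }X_{i+1}=v)=\mathrm{Prob}(X_i=u)\,U(u\rightarrow v)$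 for any non-maximal $i\in I$ and any $u,v\in\Omega$. It is a $D$-chain if $\mathrm{Prob}(X_i=u\text{ and }X_{i-1}=v)=\mathrm{Prob}(X_i=u)\,D(u\rightarrow v)$ for any non-minimal $i\in I$ and any $u,v\in\Omega$. $U$ and $D$ are strongly compatible if there is a Markov chain that is both a maximal $U$-chain and a maximal $D$-chain. A $UD$-chain is a Markov chain $(X^{(0)},X^{(1)},\dotsc)$ on $\Omega$ such that $\mathrm{Prob}(X^{(t)}=u\text{ and }X^{(t+1)}=v)$ equals $\mathrm{Prob}(X^{(t)}=u)\,U(u\rightarrow v)$ if $t$ is even and $\mathrm{Prob}(X^{(t)}=u)\,D(u\rightarrow v)$ if $t$ is odd.
   Formalization: In (b), the sequence X_i, X_{i+1}, X_i, … is replaced by a Markov chain whose consecutive pairs have alternately the laws of (X_i, X_{i+1}) and (X_{i+1}, X_i); the literal sequence need not be Markov, since its third entry equals its first. *)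

theory Defs
  imports "HOL-Probability.Probability"
begin

definition int_interval :: "int set \<Rightarrow> bool" where
  "int_interval I \<longleftrightarrow> (\<forall>a\<in>I. \<forall>b\<in>I. {a..b} \<subseteq> I)"

text \<open>The poset is a set \<open>\<Omega>\<close> with the order induced from the ambient type.\<close>

definition covers :: "'a::order set \<Rightarrow> 'a \<Rightarrow> 'a \<Rightarrow> bool" where
  "covers \<Omega> u v \<longleftrightarrow> u \<in> \<Omega> \<and> v \<in> \<Omega> \<and> u < v \<and> \<not> (\<exists>w\<in>\<Omega>. u < w \<and> w < v)"

definition graded_poset :: "int set \<Rightarrow> 'a::order set \<Rightarrow> ('a \<Rightarrow> int) \<Rightarrow> bool" where
  "graded_poset I \<Omega> \<rho> \<longleftrightarrow>
     int_interval I \<and> countable \<Omega> \<and> \<rho> ` \<Omega> = I \<and>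
     (\<forall>u\<in>\<Omega>. \<forall>v\<in>\<Omega>. u < v \<longrightarrow> \<rho> u < \<rho> v) \<and>
     (\<forall>u\<in>\<Omega>. \<forall>v\<in>\<Omega>. covers \<Omega> u v \<longrightarrow> \<rho> v = \<rho> u + 1)"

definition level :: "'a set \<Rightarrow> ('a \<Rightarrow> int) \<Rightarrow> int \<Rightarrow> 'a set" where
  "level \<Omega> \<rho> i = {u \<in> \<Omega>. \<rho> u = i}"

definition nonmaximal :: "int set \<Rightarrow> int \<Rightarrow> bool" where
  "nonmaximal I i \<longleftrightarrow> i \<in> I \<and> (\<exists>j\<in>I. i < j)"

definition nonminimal :: "int set \<Rightarrow> int \<Rightarrow> bool" where
  "nonminimal I i \<longleftrightarrow> i \<in> I \<and> (\<exists>j\<in>I. j < i)"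

definition up_rule ::
  "int set \<Rightarrow> 'a::order set \<Rightarrow> ('a \<Rightarrow> int) \<Rightarrow> ('a \<Rightarrow> 'a \<Rightarrow> real) \<Rightarrow> bool" where
  "up_rule I \<Omega> \<rho> U \<longleftrightarrow>
     (\<forall>u\<in>\<Omega>. \<forall>v\<in>\<Omega>. 0 \<le> U u v \<and> U u v \<le> 1 \<and> (U u v > 0 \<longleftrightarrow> covers \<Omega> u v)) \<and>
     (\<forall>u\<in>\<Omega>. nonmaximal I (\<rho> u) \<longrightarrow> (U u has_sum 1) \<Omega>)"

definition down_rule ::
  "int set \<Rightarrow> 'a::order set \<Rightarrow> ('a \<Rightarrow> int) \<Rightarrow> ('a \<Rightarrow> 'a \<Rightarrow> real) \<Rightarrow> bool" where
  "down_rule I \<Omega> \<rho> D \<longleftrightarrow>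
     (\<forall>u\<in>\<Omega>. \<forall>v\<in>\<Omega>. 0 \<le> D u v \<and> D u v \<le> 1 \<and> (D u v > 0 \<longleftrightarrow> covers \<Omega> v u)) \<and>
     (\<forall>u\<in>\<Omega>. nonminimal I (\<rho> u) \<longrightarrow> (D u has_sum 1) \<Omega>)"

text \<open>A (not necessarily time-homogeneous) Markov chain on the probability space \<open>M\<close>, with
  set of times \<open>T\<close> and state space \<open>S t\<close> at time \<open>t\<close>. The state spaces are meant to be
  countable. The set \<open>F\<close> is a finite set of times with latest element \<open>s\<close>; the positivity
  condition is needed because \<open>cond_prob\<close> is \<open>0\<close> when conditioning on a null event.\<close>

definition markov_chain ::
  "'b measure \<Rightarrow> 't::linorder set \<Rightarrow> ('t \<Rightarrow> 'a set) \<Rightarrow> ('t \<Rightarrow> 'b \<Rightarrow> 'a) \<Rightarrow> bool" where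
  "markov_chain M T S X \<longleftrightarrow>
     prob_space M \<and>
     (\<forall>t\<in>T. X t \<in> M \<rightarrow>\<^sub>M count_space (S t)) \<and>
     (\<forall>F s t x. finite F \<and> F \<subseteq> T \<and> s \<in> F \<and> (\<forall>r\<in>F. r \<le> s) \<and> t \<in> T \<and> s < t \<and>
        \<P>(\<omega> in M. \<forall>r\<in>F. X r \<omega> = x r) > 0 \<longrightarrow>
        \<P>(\<omega> in M. X t \<omega> = x t \<bar> \<forall>r\<in>F. X r \<omega> = x r) =
        \<P>(\<omega> in M. X t \<omega> = x t \<bar> X s \<omega> = x s))"

definition U_chain :: "int set \<Rightarrow> 'a::order set \<Rightarrow> ('a \<Rightarrow> int) \<Rightarrow> ('a \<Rightarrow> 'a \<Rightarrow> real) \<Rightarrow>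
    'b measure \<Rightarrow> (int \<Rightarrow> 'b \<Rightarrow> 'a) \<Rightarrow> bool" where
  "U_chain I \<Omega> \<rho> U M X \<longleftrightarrow>
     markov_chain M I (level \<Omega> \<rho>) X \<and>
     (\<forall>i. nonmaximal I i \<longrightarrow> (\<forall>u\<in>\<Omega>. \<forall>v\<in>\<Omega>.
        \<P>(\<omega> in M. X i \<omega> = u \<and> X (i + 1) \<omega> = v) = \<P>(\<omega> in M. X i \<omega> = u) * U u v))"

definition D_chain :: "int set \<Rightarrow> 'a::order set \<Rightarrow> ('a \<Rightarrow> int) \<Rightarrow> ('a \<Rightarrow> 'a \<Rightarrow> real) \<Rightarrow>
    'b measure \<Rightarrow> (int \<Rightarrow> 'b \<Rightarrow> 'a) \<Rightarrow> bool" where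
  "D_chain I \<Omega> \<rho> D M X \<longleftrightarrow>
     markov_chain M I (level \<Omega> \<rho>) X \<and>
     (\<forall>i. nonminimal I i \<longrightarrow> (\<forall>u\<in>\<Omega>. \<forall>v\<in>\<Omega>.
        \<P>(\<omega> in M. X i \<omega> = u \<and> X (i - 1) \<omega> = v) = \<P>(\<omega> in M. X i \<omega> = u) * D u v))"

text \<open>Existence of a chain is existence on some probability space over the type of
  paths. This loses no generality: the law of any chain lives on path space.\<close>

definition strongly_compatible :: "int set \<Rightarrow> 'a::order set \<Rightarrow> ('a \<Rightarrow> int) \<Rightarrow>
    ('a \<Rightarrow> 'a \<Rightarrow> real) \<Rightarrow> ('a \<Rightarrow> 'a \<Rightarrow> real) \<Rightarrow> bool" where
  "strongly_compatible I \<Omega> \<rho> U D \<longleftrightarrow>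
     (\<exists>(N :: (int \<Rightarrow> 'a) measure) X. U_chain I \<Omega> \<rho> U N X \<and> D_chain I \<Omega> \<rho> D N X)"

definition UD_chain :: "'a::order set \<Rightarrow> ('a \<Rightarrow> 'a \<Rightarrow> real) \<Rightarrow> ('a \<Rightarrow> 'a \<Rightarrow> real) \<Rightarrow>
    'b measure \<Rightarrow> (nat \<Rightarrow> 'b \<Rightarrow> 'a) \<Rightarrow> bool" where
  "UD_chain \<Omega> U D N Y \<longleftrightarrow>
     markov_chain N UNIV (\<lambda>t. \<Omega>) Y \<and>
     (\<forall>t. \<forall>u\<in>\<Omega>. \<forall>v\<in>\<Omega>.
        \<P>(\<omega> in N. Y t \<omega> = u \<and> Y (t + 1) \<omega> = v) =
        \<P>(\<omega> in N. Y t \<omega> = u) * (if even t then U u v else D u v))"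

text \<open>The sequence \<open>X\<^sub>i, X\<^sub>i\<^sub>+\<^sub>1, X\<^sub>i, X\<^sub>i\<^sub>+\<^sub>1, \<dots>\<close> is read as a Markov chain in law: each
  step has the joint law of \<open>(X\<^sub>i, X\<^sub>i\<^sub>+\<^sub>1)\<close> or \<open>(X\<^sub>i\<^sub>+\<^sub>1, X\<^sub>i)\<close>, alternately; for a Markov chain
  this determines the law. Taken literally, as random variables on a single sample space,
  the sequence is in general not Markov, since its third entry is equal to its first.\<close>

definition alternation ::
  "'a set \<Rightarrow> 'b measure \<Rightarrow> (int \<Rightarrow> 'b \<Rightarrow> 'a) \<Rightarrow> int \<Rightarrow> 'c measure \<Rightarrow> (nat \<Rightarrow> 'c \<Rightarrow> 'a) \<Rightarrow> bool" where
  "alternation \<Omega> M X i N Y \<longleftrightarrow>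
     markov_chain N UNIV (\<lambda>t. \<Omega>) Y \<and>
     (\<forall>t. \<forall>u\<in>\<Omega>. \<forall>v\<in>\<Omega>.
        \<P>(\<omega> in N. Y t \<omega> = u \<and> Y (t + 1) \<omega> = v) =
        (if even t then \<P>(\<omega> in M. X i \<omega> = u \<and> X (i + 1) \<omega> = v)
         else \<P>(\<omega> in M. X (i + 1) \<omega> = u \<and> X i \<omega> = v)))"

definition alternation_is_UD_chain :: "'a::order set \<Rightarrow> ('a \<Rightarrow> 'a \<Rightarrow> real) \<Rightarrow>
    ('a \<Rightarrow> 'a \<Rightarrow> real) \<Rightarrow> 'b measure \<Rightarrow> (int \<Rightarrow> 'b \<Rightarrow> 'a) \<Rightarrow> int \<Rightarrow> bool" where
  "alternation_is_UD_chain \<Omega> U D M X i \<longleftrightarrow>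
     (\<exists>(N :: (nat \<Rightarrow> 'a) measure) Y. alternation \<Omega> M X i N Y \<and> UD_chain \<Omega> U D N Y)"

end

theory Submission
  imports Defs
begin

text \<open>
  Both sides of the equivalence say the same thing about each edge \<open>(i, i + 1)\<close> of \<open>I\<close>, namely
  that for all \<open>u\<close> and \<open>v\<close> in \<open>\<Omega>\<close>
  \<open>P(X\<^sub>i = u, X\<^sub>i\<^sub>+\<^sub>1 = v) = P(X\<^sub>i = u) U(u, v) = P(X\<^sub>i\<^sub>+\<^sub>1 = v) D(v, u)\<close>:
  the joint law is given by the up rule and also by the down rule.

  For (a) this is the definition, once the condition of a \<open>D\<close>-chain at \<open>i\<close> is read as a condition
  on the edge \<open>(i - 1, i)\<close> (\<open>U_chain_D_chain_iff\<close>). For (b), any alternation \<open>Y\<close> of \<open>X\<^sub>i\<close> and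
  \<open>X\<^sub>i\<^sub>+\<^sub>1\<close> has prescribed laws of pairs \<open>(Y\<^sub>t, Y\<^sub>t\<^sub>+\<^sub>1)\<close>; summing over the second component
  shows that \<open>Y\<^sub>t\<close> is distributed like \<open>X\<^sub>i\<close> or like \<open>X\<^sub>i\<^sub>+\<^sub>1\<close>, according to the parity of \<open>t\<close>
  (\<open>alternation_marginal\<close>). So the condition of a \<open>UD\<close>-chain at time \<open>t\<close> is the first of the two
  equations when \<open>t\<close> is even and the second when \<open>t\<close> is odd (\<open>alternation_is_UD_chain_iff\<close>).

  What remains, and takes most of the work, is that an alternation exists at all. It does for every
  pair of random variables, and more generally every sequence of random variables \<open>A\<^sub>0, A\<^sub>1, \<dots>\<close>
  in a countable set can be replaced by a Markov chain with the same laws of consecutive pairs: take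
  \<open>P(A\<^sub>t\<^sub>+\<^sub>1 = v | A\<^sub>t = u)\<close> as transition probabilities
  (\<open>markov_chain_with_same_pair_laws\<close>). The chain itself comes from the Ionescu-Tulcea theorem
  (\<open>Ionescu_Tulcea_chain\<close>).

  Strong compatibility asks for a chain on the space of paths. The law of the given chain on that
  space is such a chain (\<open>strongly_compatibleI\<close>).
\<close>

section \<open>Random variables with countably many values\<close>

lemma emeasure_partition_by_countable:
  assumes S: "countable S" and Y: "Y \<in> M \<rightarrow>\<^sub>M count_space S" and Q: "{\<omega> \<in> space M. Q \<omega>} \<in> sets M"
  shows "emeasure M {\<omega> \<in> space M. Q \<omega>}
       = (\<integral>\<^sup>+v. emeasure M {\<omega> \<in> space M. Q \<omega> \<and> Y \<omega> = v} \<partial>count_space S)"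
proof -
  have eq: "{\<omega> \<in> space M. Q \<omega>} = (\<Union>v\<in>S. {\<omega> \<in> space M. Q \<omega> \<and> Y \<omega> = v})"
    using measurable_space[OF Y] by auto
  have m: "{\<omega> \<in> space M. Q \<omega> \<and> Y \<omega> = v} \<in> sets M" if "v \<in> S" for v
  proof -
    have "{\<omega> \<in> space M. Q \<omega> \<and> Y \<omega> = v} = {\<omega> \<in> space M. Q \<omega>} \<inter> (Y -` {v} \<inter> space M)"
      by auto
    then show ?thesis using Q measurable_sets[OF Y, of "{v}"] that by auto
  qed
  show ?thesis
    unfolding eq by (subst emeasure_UN_countable) (use S m in \<open>auto simp: disjoint_family_on_def\<close>)
qed

lemma sets_eq_values:
  assumes "finite F" and "\<And>r. r \<in> F \<Longrightarrow> Y r \<in> M \<rightarrow>\<^sub>M count_space (S r)"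
  shows "{\<omega> \<in> space M. \<forall>r\<in>F. Y r \<omega> = x r} \<in> sets M"
proof (rule sets.sets_Collect_finite_All[OF _ assms(1)])
  fix r assume "r \<in> F"
  have "{\<omega> \<in> space M. Y r \<omega> = x r} = Y r -` ({x r} \<inter> S r) \<inter> space M"
    using measurable_space[OF assms(2)[OF \<open>r \<in> F\<close>]] by auto
  also have "\<dots> \<in> sets M"
    by (rule measurable_sets[OF assms(2)[OF \<open>r \<in> F\<close>]]) auto
  finally show "{\<omega> \<in> space M. Y r \<omega> = x r} \<in> sets M" .
qed

section \<open>From one step to the Markov property\<close>

text \<open>
  The equation is required for conditions at arbitrary finite sets of times up to \<open>n\<close>, with \<open>n\<close>
  among them: this is the Markov property for a single step. As a
  product, and not as a quotient of probabilities, it can be summed over intermediate states without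
  treating null events separately.
\<close>

definition transition_kernel ::
    "'b measure \<Rightarrow> 'a set \<Rightarrow> (nat \<Rightarrow> 'b \<Rightarrow> 'a) \<Rightarrow> (nat \<Rightarrow> 'a \<Rightarrow> 'a \<Rightarrow> ennreal) \<Rightarrow> bool" where
  "transition_kernel M S Y k \<longleftrightarrow>
    (\<forall>n F x. finite F \<and> F \<subseteq> {..n} \<and> n \<in> F \<and> x n \<in> S \<and> x (Suc n) \<in> S \<longrightarrow>
       emeasure M {\<omega> \<in> space M. \<forall>r\<in>insert (Suc n) F. Y r \<omega> = x r}
     = emeasure M {\<omega> \<in> space M. \<forall>r\<in>F. Y r \<omega> = x r} * k n (x n) (x (Suc n)))"

lemma transition_kernelD:
  assumes "transition_kernel M S Y k" "finite F" "F \<subseteq> {..n}" "n \<in> F" "x n \<in> S" "x (Suc n) \<in> S"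
  shows "emeasure M {\<omega> \<in> space M. \<forall>r\<in>insert (Suc n) F. Y r \<omega> = x r}
     = emeasure M {\<omega> \<in> space M. \<forall>r\<in>F. Y r \<omega> = x r} * k n (x n) (x (Suc n))"
  by (rule assms(1)[unfolded transition_kernel_def, THEN spec[of _ n], THEN spec[of _ F],
        THEN spec[of _ x], THEN mp]) (intro conjI assms(2-))

text \<open>
  The Markov property asks for transitions over arbitrarily many steps, from an arbitrary finite past.
  They are governed by the iterated kernels, as in the Chapman-Kolmogorov equation: split according
  to the state \<open>z\<close> at the last intermediate time, and use the one-step equation with that time
  added to the past. The kernel \<open>K\<close> is found before \<open>F\<close> and \<open>x\<close>, so the same \<open>K\<close> serves for
  the full past and for the present alone.
\<close>

lemma markov_property_iterate:
  fixes Y :: "nat \<Rightarrow> 'b \<Rightarrow> 'a" and k :: "nat \<Rightarrow> 'a \<Rightarrow> 'a \<Rightarrow> ennreal"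
  assumes S: "countable S" and Y: "\<And>t. Y t \<in> M \<rightarrow>\<^sub>M count_space S"
    and k: "transition_kernel M S Y k"
  shows "\<exists>K. \<forall>F x. finite F \<and> F \<subseteq> {..s} \<and> s \<in> F \<and> x s \<in> S \<and> x (s + Suc d) \<in> S \<longrightarrow>
       emeasure M {\<omega> \<in> space M. \<forall>r\<in>insert (s + Suc d) F. Y r \<omega> = x r}
     = emeasure M {\<omega> \<in> space M. \<forall>r\<in>F. Y r \<omega> = x r} * K (x s) (x (s + Suc d))"
proof (induction d)
  case 0
  show ?case
    by (intro exI[of _ "k s"] allI impI) (simp only: add_Suc_right add_0_right transition_kernelD[OF k])
next
  case (Suc d)
  let ?t = "s + Suc d"
  let ?E = "\<lambda>F x. {\<omega> \<in> space M. \<forall>r\<in>F. Y r \<omega> = x r}"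
  from Suc obtain K where K: "\<And>F x. finite F \<Longrightarrow> F \<subseteq> {..s} \<Longrightarrow> s \<in> F \<Longrightarrow> x s \<in> S \<Longrightarrow> x ?t \<in> S \<Longrightarrow>
       emeasure M (?E (insert ?t F) x) = emeasure M (?E F x) * K (x s) (x ?t)"
    by blast
  let ?K = "\<lambda>u y. \<integral>\<^sup>+z. K u z * k ?t z y \<partial>count_space S"
  show ?case
  proof (intro exI[of _ ?K] allI impI, elim conjE)
    fix F and x :: "nat \<Rightarrow> 'a"
    assume F: "finite F" "F \<subseteq> {..s}" "s \<in> F" "x s \<in> S" "x (s + Suc (Suc d)) \<in> S"
    then have nF: "?t \<notin> F" "Suc ?t \<notin> F" by auto
    let ?y = "x (Suc ?t)"
    have "emeasure M (?E (insert (Suc ?t) F) x)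
        = (\<integral>\<^sup>+z. emeasure M {\<omega> \<in> space M. (\<forall>r\<in>insert (Suc ?t) F. Y r \<omega> = x r) \<and> Y ?t \<omega> = z} \<partial>count_space S)"
      by (rule emeasure_partition_by_countable[OF S Y]) (intro sets_eq_values[where S="\<lambda>_. S"] Y, use F in simp)
    also have "\<dots> = (\<integral>\<^sup>+z. emeasure M (?E F x) * (K (x s) z * k ?t z ?y) \<partial>count_space S)"
    proof (rule nn_integral_cong)
      fix z assume "z \<in> space (count_space S)"
      then have z: "z \<in> S" by simp
      let ?x = "x(?t := z)"
      have split: "{\<omega> \<in> space M. (\<forall>r\<in>insert (Suc ?t) F. Y r \<omega> = x r) \<and> Y ?t \<omega> = z}
          = ?E (insert (Suc ?t) (insert ?t F)) ?x"
        and same: "?E F ?x = ?E F x" using nF by auto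
      have "insert ?t F \<subseteq> {..?t}" using F(2) by auto
      moreover have "?x ?t \<in> S" "?x (Suc ?t) \<in> S" using z F(5) by simp_all
      ultimately have last: "emeasure M (?E (insert (Suc ?t) (insert ?t F)) ?x)
          = emeasure M (?E (insert ?t F) ?x) * k ?t (?x ?t) (?x (Suc ?t))"
        using F(1) by (intro transition_kernelD[OF k]) simp_all
      have "emeasure M (?E (insert ?t F) ?x) = emeasure M (?E F ?x) * K (?x s) (?x ?t)"
        by (rule K) (use F z in simp_all)
      with last show "emeasure M {\<omega> \<in> space M. (\<forall>r\<in>insert (Suc ?t) F. Y r \<omega> = x r) \<and> Y ?t \<omega> = z}
         = emeasure M (?E F x) * (K (x s) z * k ?t z ?y)"
        unfolding split same by (simp add: mult.assoc del: insert_iff ball_simps)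
    qed
    also have "\<dots> = emeasure M (?E F x) * ?K (x s) ?y"
      by (rule nn_integral_cmult) simp
    finally show "emeasure M (?E (insert (s + Suc (Suc d)) F) x) = emeasure M (?E F x) * ?K (x s) (x (s + Suc (Suc d)))"
      by simp
  qed
qed

text \<open>
  Both conditional probabilities in the Markov property, given \<open>F\<close> and given \<open>{s}\<close>, are equal to
  the multi-step transition probability from \<open>x s\<close> to \<open>x t\<close>.
\<close>

lemma markov_chainI_one_step:
  fixes Y :: "nat \<Rightarrow> 'b \<Rightarrow> 'a" and k :: "nat \<Rightarrow> 'a \<Rightarrow> 'a \<Rightarrow> ennreal"
  assumes M: "prob_space M" and S: "countable S" and Y: "\<And>t. Y t \<in> M \<rightarrow>\<^sub>M count_space S"
    and k: "transition_kernel M S Y k"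
  shows "markov_chain M UNIV (\<lambda>_. S) Y"
  unfolding markov_chain_def
proof (intro conjI allI impI ballI M Y, elim conjE)
  interpret prob_space M by (rule M)
  fix F :: "nat set" and s t and x :: "nat \<Rightarrow> 'a"
  assume F: "finite F" "s \<in> F" "\<forall>r\<in>F. r \<le> s" "s < t"
    and pos: "0 < \<P>(\<omega> in M. \<forall>r\<in>F. Y r \<omega> = x r)"
  let ?E = "\<lambda>F. {\<omega> \<in> space M. \<forall>r\<in>F. Y r \<omega> = x r}"
  have sets: "?E G \<in> sets M" if "finite G" for G
    by (intro sets_eq_values[where S="\<lambda>_. S"] Y that)
  show "\<P>(\<omega> in M. Y t \<omega> = x t \<bar> \<forall>r\<in>F. Y r \<omega> = x r) = \<P>(\<omega> in M. Y t \<omega> = x t \<bar> Y s \<omega> = x s)"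
  proof (cases "x t \<in> S")
    case False
    then have "Y t \<omega> \<noteq> x t" if "\<omega> \<in> space M" for \<omega>
      using measurable_space[OF Y that, of t] by auto
    then have empty: "{\<omega> \<in> space M. Y t \<omega> = x t \<and> Q \<omega>} = {}" for Q
      by blast
    show ?thesis unfolding cond_prob_def empty by simp
  next
    case True
    from pos have "?E F \<noteq> {}" by (metis less_irrefl measure_empty)
    then have xs: "x s \<in> S" using F measurable_space[OF Y, of _ s] by force
    obtain d where d: "t = s + Suc d" using \<open>s < t\<close> by (metis less_iff_Suc_add add_Suc_right)
    obtain K where K: "\<And>G. finite G \<Longrightarrow> G \<subseteq> {..s} \<Longrightarrow> s \<in> G \<Longrightarrow>
        emeasure M (?E (insert t G)) = emeasure M (?E G) * K (x s) (x t)"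
      using markov_property_iterate[OF S Y k, of s d] True xs unfolding d by blast
    \<comment> \<open>To be used for the whole past \<open>G = F\<close> and for the present \<open>G = {s}\<close>.\<close>
    have cond: "measure M (?E (insert t G)) / measure M (?E G) = enn2real (K (x s) (x t))"
      if "finite G" "G \<subseteq> {..s}" "s \<in> G" "measure M (?E G) > 0" for G
      using K[OF that(1-3)] that(4) by (simp add: measure_def enn2real_mult)
    have "measure M (?E F) \<le> measure M (?E {s})"
      by (rule finite_measure_mono) (use F sets[of "{s}"] in auto)
    with pos have "measure M (?E {s}) > 0" by linarith
    then show ?thesis
      using cond[of F] cond[of "{s}"] F pos
      by (auto simp: cond_prob_def subset_iff conj_commute)
  qed
qed

section \<open>Existence of Markov chains with given transition probabilities\<close>

text \<open>
  The Ionescu-Tulcea theorem gives a measure on sequences from conditional laws that may depend on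
  the whole past; here the conditional law depends on the last coordinate only. The probability of
  an event that restricts only the coordinates below \<open>n\<close> can be computed from the first \<open>n\<close>
  coordinates, and one further integration against the kernel gives the one-step equation.
\<close>

lemma Ionescu_Tulcea_chain:
  fixes S :: "'a set" and p :: "'a \<Rightarrow> ennreal" and k :: "nat \<Rightarrow> 'a \<Rightarrow> 'a \<Rightarrow> ennreal"
  assumes S: "countable S"
    and p: "(\<integral>\<^sup>+v. p v \<partial>count_space S) = 1"
    and k: "\<And>n u. u \<in> S \<Longrightarrow> (\<integral>\<^sup>+v. k n u v \<partial>count_space S) = 1"
  obtains N :: "(nat \<Rightarrow> 'a) measure" where "prob_space N"
    and "\<forall>t. (\<lambda>\<omega>. \<omega> t) \<in> N \<rightarrow>\<^sub>M count_space S"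
    and "\<forall>u\<in>S. emeasure N {\<omega> \<in> space N. \<omega> 0 = u} = p u"
    and "transition_kernel N S (\<lambda>t \<omega>. \<omega> t) k"
proof -
  \<comment> \<open>The conditional density of coordinate \<open>n\<close> given the coordinates \<open>\<omega>\<close> before it; the initial
    law is the case of an empty past.\<close>
  define q where "q n \<omega> v = (if n = 0 then p v else k (n - 1) (\<omega> (n - 1)) v)" for n and \<omega> :: "nat \<Rightarrow> 'a" and v
  define M where "M = (\<lambda>_::nat. count_space S)"
  define P where "P n \<omega> = density (count_space S) (q n \<omega>)" for n \<omega>
  have q_row: "(\<integral>\<^sup>+v. q n \<omega> v \<partial>count_space S) = 1" if "\<omega> \<in> space (PiM {0..<n} M)" for n \<omega>
  proof (cases n)
    case (Suc m)
    then have "\<omega> m \<in> S" using that by (auto simp: space_PiM M_def)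
    then show ?thesis using Suc k by (simp add: q_def)
  qed (simp add: q_def p)
  have density: "prob_space (density (count_space S) f)" if "(\<integral>\<^sup>+v. f v \<partial>count_space S) = 1" for f
  proof (rule prob_spaceI)
    have "(\<integral>\<^sup>+v. f v * indicator S v \<partial>count_space S) = (\<integral>\<^sup>+v. f v \<partial>count_space S)"
      by (rule nn_integral_cong) simp
    then show "emeasure (density (count_space S) f) (space (density (count_space S) f)) = 1"
      by (simp add: emeasure_density that)
  qed
  have density_space: "density (count_space S) f \<in> space (subprob_algebra (M n))"
    if "(\<integral>\<^sup>+v. f v \<partial>count_space S) = 1" for f n
    using prob_space_imp_subprob_space[OF density[OF that]] by (simp add: space_subprob_algebra M_def)
  have P_prob: "prob_space (P n \<omega>)" if "\<omega> \<in> space (PiM {0..<n} M)" for n \<omega>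
    unfolding P_def by (rule density) (rule q_row[OF that])
  have P_meas: "P n \<in> PiM {0..<n} M \<rightarrow>\<^sub>M subprob_algebra (M n)" for n
  proof (cases n)
    case 0
    have "q 0 \<omega> = p" for \<omega> by (simp add: q_def fun_eq_iff)
    then have "P 0 = (\<lambda>\<omega>. density (count_space S) p)" by (intro ext) (simp only: P_def)
    moreover have "density (count_space S) p \<in> space (subprob_algebra (M 0))"
      by (rule density_space) (rule p)
    ultimately show ?thesis using 0 by simp
  next
    case (Suc m)
    have "(\<lambda>u. density (count_space S) (k m u)) \<in> count_space S \<rightarrow>\<^sub>M subprob_algebra (M n)"
      unfolding measurable_count_space_eq1 by (intro Pi_I density_space k)
    moreover have "(\<lambda>\<omega>. \<omega> m) \<in> PiM {0..<n} M \<rightarrow>\<^sub>M count_space S"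
      using measurable_component_singleton[of m "{0..<n}" M] Suc by (simp add: M_def)
    ultimately have "(\<lambda>\<omega>. density (count_space S) (k m (\<omega> m))) \<in> PiM {0..<n} M \<rightarrow>\<^sub>M subprob_algebra (M n)"
      by (rule measurable_compose[rotated])
    moreover have "q n \<omega> = k m (\<omega> m)" for \<omega> using Suc by (simp add: q_def fun_eq_iff)
    then have "P n = (\<lambda>\<omega>. density (count_space S) (k m (\<omega> m)))" by (intro ext) (simp only: P_def)
    ultimately show ?thesis by simp
  qed
  interpret IT: Ionescu_Tulcea P M
    by (rule Ionescu_Tulcea.intro) (rule P_meas, rule P_prob)
  let ?N = "IT.PF.lim"
  let ?C = "\<lambda>n. IT.C 0 n (\<lambda>_. undefined)"
  let ?E = "\<lambda>F x n. {\<omega> \<in> space (PiM {0..<n} M). \<forall>r\<in>F. \<omega> r = x r}"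
  have undef: "(\<lambda>_. undefined) \<in> space (PiM {0..<0} M)" by simp
  have E_sets: "?E F x n \<in> sets (PiM {0..<n} M)" if "F \<subseteq> {..<n}" for F x n
  proof (rule sets_eq_values[where S="\<lambda>_. S"])
    show "finite F" using that by (rule finite_subset) simp
    fix r assume "r \<in> F"
    then have "r \<in> {0..<n}" using that by auto
    then show "(\<lambda>\<omega>. \<omega> r) \<in> PiM {0..<n} M \<rightarrow>\<^sub>M count_space S"
      using measurable_component_singleton[of r "{0..<n}" M] by (simp add: M_def)
  qed
  have lim_C: "emeasure ?N {\<omega> \<in> space ?N. \<forall>r\<in>F. \<omega> r = x r} = emeasure (?C n) (?E F x n)"
    if "F \<subseteq> {..<n}" for F x n
  proof -
    have "{\<omega> \<in> space ?N. \<forall>r\<in>F. \<omega> r = x r} = IT.PF.emb UNIV {0..<n} (?E F x n)"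
      using that by (auto simp: prod_emb_def space_PiM IT.PF.space_lim subset_iff)
    also have "emeasure ?N \<dots> = emeasure (IT.CI {0..<n}) (?E F x n)"
      by (rule IT.lim) (simp_all add: E_sets that)
    also have "\<dots> = emeasure (?C n) (IT.PF.emb {0..<n} {0..<n} (?E F x n))"
      by (rule IT.emeasure_CI) (simp_all add: E_sets that)
    also have "IT.PF.emb {0..<n} {0..<n} (?E F x n) = ?E F x n"
      by (rule prod_emb_id) (auto simp: space_PiM)
    finally show ?thesis .
  qed
  have C_Suc: "emeasure (?C (Suc n)) (?E (insert n F) x (Suc n))
      = (\<integral>\<^sup>+\<omega>. indicator (?E F x n) \<omega> * q n \<omega> (x n) \<partial>?C n)"
    if F: "F \<subseteq> {..<n}" and xn: "x n \<in> S" for F x n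
  proof -
    let ?B = "?E (insert n F) x (Suc n)"
    have B: "?B \<in> sets (PiM {0..<Suc n} M)" using F by (intro E_sets) auto
    have ne: "space (?C n) \<noteq> {}"
      using IT.prob_space_C[OF undef] by (rule prob_space.not_empty)
    have sC: "sets (?C n) = sets (PiM {0..<n} M)" "space (?C n) = space (PiM {0..<n} M)"
      using IT.sets_C[OF undef, of n] IT.space_C[OF undef, of n] by simp_all
    have "emeasure (?C (Suc n)) ?B = (\<integral>\<^sup>+\<omega>. emeasure (IT.eP n \<omega>) ?B \<partial>?C n)"
      using emeasure_bind[OF ne _ B, of "IT.eP n"] IT.measurable_eP[of n] 
      by (simp add: measurable_cong_sets[OF sC(1) refl])
    also have "\<dots> = (\<integral>\<^sup>+\<omega>. indicator (?E F x n) \<omega> * q n \<omega> (x n) \<partial>?C n)"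
    proof (rule nn_integral_cong)
      fix \<omega> assume "\<omega> \<in> space (?C n)"
      then have \<omega>: "\<omega> \<in> space (PiM {0..<n} M)" by (simp add: sC)
      have up: "fun_upd \<omega> n v \<in> space (PiM {0..<Suc n} M)" if "v \<in> S" for v
        using \<omega> that by (auto simp: space_PiM M_def PiE_iff extensional_def)
      have "emeasure (IT.eP n \<omega>) ?B = emeasure (P n \<omega>) ((\<lambda>v. fun_upd \<omega> n v) -` ?B \<inter> S)"
        using IT.emeasure_eP[OF \<omega> B] by (simp add: M_def)
      also have "(\<lambda>v. fun_upd \<omega> n v) -` ?B \<inter> S = (if \<omega> \<in> ?E F x n then {x n} else {})"
        using up xn \<omega> F by (auto simp: subset_iff)
      also have "emeasure (P n \<omega>) \<dots> = indicator (?E F x n) \<omega> * q n \<omega> (x n)"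
        using xn by (simp add: P_def emeasure_density nn_integral_indicator_singleton emeasure_count_space)
      finally show "emeasure (IT.eP n \<omega>) ?B = indicator (?E F x n) \<omega> * q n \<omega> (x n)" .
    qed
    finally show ?thesis .
  qed
  show thesis
  proof (rule that[of ?N])
    show "prob_space ?N"
    proof (rule prob_spaceI)
      have "emeasure ?N (space ?N) = emeasure (?C 0) (space (?C 0))"
        using lim_C[of "{}" 0] by simp
      also have "\<dots> = 1" by (rule prob_space.emeasure_space_1[OF IT.prob_space_C[OF undef]])
      finally show "emeasure ?N (space ?N) = 1" .
    qed
    have "(\<lambda>\<omega>. \<omega> t) \<in> ?N \<rightarrow>\<^sub>M count_space S" for t
    proof -
      have Mt: "M t = count_space S" by (simp add: M_def)
      have "(\<lambda>\<omega>. \<omega> t) \<in> ?N \<rightarrow>\<^sub>M M t"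
        unfolding measurable_cong_sets[OF IT.PF.sets_lim refl]
        by (rule measurable_component_singleton) simp
      then show ?thesis unfolding Mt .
    qed
    then show "\<forall>t. (\<lambda>\<omega>. \<omega> t) \<in> ?N \<rightarrow>\<^sub>M count_space S" by blast
    show "\<forall>u\<in>S. emeasure ?N {\<omega> \<in> space ?N. \<omega> 0 = u} = p u"
    proof
      fix u assume u: "u \<in> S"
      have "emeasure ?N {\<omega> \<in> space ?N. \<omega> 0 = u}
          = (\<integral>\<^sup>+\<omega>. indicator (?E {} (\<lambda>_. u) 0) \<omega> * q 0 \<omega> u \<partial>?C 0)"
        using lim_C[of "{0}" "Suc 0" "\<lambda>_. u"] C_Suc[of "{}" 0 "\<lambda>_. u"] u
        by (simp del: IT.C.simps)
      also have "\<dots> = (\<integral>\<^sup>+\<omega>. p u \<partial>?C 0)"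
        by (rule nn_integral_cong) (simp add: q_def IT.space_C[OF undef] indicator_def)
      also have "\<dots> = p u"
        using prob_space.emeasure_space_1[OF IT.prob_space_C[OF undef, of 0]] by simp
      finally show "emeasure ?N {\<omega> \<in> space ?N. \<omega> 0 = u} = p u" .
    qed
    show "transition_kernel ?N S (\<lambda>t \<omega>. \<omega> t) k"
      unfolding transition_kernel_def
    proof (intro allI impI, elim conjE)
      fix n F and x :: "nat \<Rightarrow> 'a"
      assume F: "finite F" "F \<subseteq> {..n}" "n \<in> F" "x n \<in> S" "x (Suc n) \<in> S"
      have F': "F \<subseteq> {..<Suc n}" using F by auto
      have "emeasure ?N {\<omega> \<in> space ?N. \<forall>r\<in>insert (Suc n) F. \<omega> r = x r}
          = (\<integral>\<^sup>+\<omega>. indicator (?E F x (Suc n)) \<omega> * q (Suc n) \<omega> (x (Suc n)) \<partial>?C (Suc n))"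
      proof -
        have "insert (Suc n) F \<subseteq> {..<Suc (Suc n)}" using F' by auto
        from trans[OF lim_C[OF this, of x] C_Suc[OF F', of x, OF F(5)]] show ?thesis .
      qed
      also have "\<dots> = (\<integral>\<^sup>+\<omega>. k n (x n) (x (Suc n)) * indicator (?E F x (Suc n)) \<omega> \<partial>?C (Suc n))"
        by (rule nn_integral_cong) (use F in \<open>auto simp: q_def indicator_def\<close>)
      also have "\<dots> = emeasure (?C (Suc n)) (?E F x (Suc n)) * k n (x n) (x (Suc n))"
        using E_sets[OF F', of x] IT.sets_C[OF undef, of "Suc n"]
        by (subst nn_integral_cmult_indicator) (simp_all add: mult.commute del: IT.C.simps)
      finally show "emeasure ?N {\<omega> \<in> space ?N. \<forall>r\<in>insert (Suc n) F. \<omega> r = x r}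
       = emeasure ?N {\<omega> \<in> space ?N. \<forall>r\<in>F. \<omega> r = x r} * k n (x n) (x (Suc n))"
        using lim_C[OF F', of x] by simp
    qed
  qed
qed

text \<open>
  The transition probabilities are the conditional probabilities \<open>P(A\<^sub>t\<^sub>+\<^sub>1 = v | A\<^sub>t = u)\<close>. By
  induction on \<open>t\<close>, the chain at time \<open>t\<close> has the law of \<open>A\<^sub>t\<close>: if this holds at time \<open>t\<close>, the
  pair at times \<open>t\<close> and \<open>t + 1\<close> has the required law, hence so has its second component.
\<close>

lemma markov_chain_with_same_pair_laws:
  fixes A :: "nat \<Rightarrow> 'b \<Rightarrow> 'a"
  assumes M: "prob_space M" and S: "countable S" and A: "\<And>t. A t \<in> M \<rightarrow>\<^sub>M count_space S"
  obtains N :: "(nat \<Rightarrow> 'a) measure" and Y where "markov_chain N UNIV (\<lambda>_. S) Y"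
    and "\<forall>t. \<forall>u\<in>S. \<forall>v\<in>S.
      \<P>(\<omega> in N. Y t \<omega> = u \<and> Y (Suc t) \<omega> = v) = \<P>(\<omega> in M. A t \<omega> = u \<and> A (Suc t) \<omega> = v)"
proof -
  interpret M: prob_space M by (rule M)
  define m where "m t u = emeasure M {\<omega> \<in> space M. A t \<omega> = u}" for t u
  define J where "J t u v = emeasure M {\<omega> \<in> space M. A t \<omega> = u \<and> A (Suc t) \<omega> = v}" for t u v
  \<comment> \<open>From a state of probability \<open>0\<close> any probability distribution will do; the chain stays put.\<close>
  define k where "k t u v = (if m t u = 0 then indicator {u} v else J t u v / m t u)" for t u v
  have m_sets: "{\<omega> \<in> space M. A t \<omega> = u} \<in> sets M" for t u
    using sets_eq_values[of "{t}" A M "\<lambda>_. S" "\<lambda>_. u"] A by simp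
  have m_total: "(\<integral>\<^sup>+u. m t u \<partial>count_space S) = 1" for t
    using emeasure_partition_by_countable[OF S A[of t], of "\<lambda>_. True"] M.emeasure_space_1
    by (simp add: m_def)
  have J_right: "(\<integral>\<^sup>+v. J t u v \<partial>count_space S) = m t u" for t u
    using emeasure_partition_by_countable[OF S A[of "Suc t"] m_sets[of t u]] by (simp add: m_def J_def)
  have J_left: "(\<integral>\<^sup>+u. J t u v \<partial>count_space S) = m (Suc t) v" for t v
    using emeasure_partition_by_countable[OF S A[of t] m_sets[of "Suc t" v]]
    by (simp add: m_def J_def conj_commute)
  have J_le: "J t u v \<le> m t u" for t u v
    unfolding J_def m_def by (rule emeasure_mono) (use m_sets in auto)
  have m_fin: "m t u < \<top>" for t u by (simp add: m_def M.emeasure_eq_measure)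
  have k_row: "(\<integral>\<^sup>+v. k t u v \<partial>count_space S) = 1" if "u \<in> S" for t u
  proof (cases "m t u = 0")
    case True
    then show ?thesis using that by (simp add: k_def)
  next
    case False
    then have "(\<integral>\<^sup>+v. k t u v \<partial>count_space S) = m t u / m t u"
      by (simp add: k_def nn_integral_divide J_right)
    then show ?thesis using ennreal_divide_self[OF False m_fin] by simp
  qed
  have m_k: "m t u * k t u v = J t u v" for t u v
  proof (cases "m t u = 0")
    case True
    then show ?thesis using J_le[of t u v] by simp
  next
    case False
    have "m t u * (J t u v / m t u) = J t u v * m t u / m t u"
      by (subst ennreal_times_divide) (subst mult.commute, rule refl)
    also have "\<dots> = J t u v"
      by (rule ennreal_mult_divide_eq[OF False]) (use m_fin[of t u] in auto)
    finally show ?thesis using False by (simp add: k_def)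
  qed
  obtain N :: "(nat \<Rightarrow> 'a) measure" where N: "prob_space N"
    and Y': "\<forall>t. (\<lambda>\<omega>. \<omega> t) \<in> N \<rightarrow>\<^sub>M count_space S"
    and init: "\<forall>u\<in>S. emeasure N {\<omega> \<in> space N. \<omega> 0 = u} = m 0 u"
    and trans: "transition_kernel N S (\<lambda>t \<omega>. \<omega> t) k"
    using Ionescu_Tulcea_chain[OF S m_total[of 0], of k, OF k_row] .
  have Y: "(\<lambda>\<omega>. \<omega> t) \<in> N \<rightarrow>\<^sub>M count_space S" for t using Y' by simp
  have pair_step: "emeasure N {\<omega> \<in> space N. \<omega> t = u \<and> \<omega> (Suc t) = v}
      = emeasure N {\<omega> \<in> space N. \<omega> t = u} * k t u v" if "u \<in> S" "v \<in> S" for t u v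
    using transition_kernelD[OF trans, of "{t}" t "\<lambda>r. if r = t then u else v"] that by (simp add: conj_commute)
  have law: "emeasure N {\<omega> \<in> space N. \<omega> t = u} = m t u" if "u \<in> S" for t u
    using that
  proof (induction t arbitrary: u)
    case (Suc t)
    have "emeasure N {\<omega> \<in> space N. \<omega> (Suc t) = u}
        = (\<integral>\<^sup>+w. emeasure N {\<omega> \<in> space N. \<omega> (Suc t) = u \<and> \<omega> t = w} \<partial>count_space S)"
      by (rule emeasure_partition_by_countable[OF S Y])
        (use sets_eq_values[of "{Suc t}" "\<lambda>t \<omega>. \<omega> t" N "\<lambda>_. S" "\<lambda>_. u"] Y in simp)
    also have "\<dots> = (\<integral>\<^sup>+w. J t w u \<partial>count_space S)"
      by (rule nn_integral_cong)
        (use pair_step Suc m_k in \<open>simp add: conj_commute\<close>)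
    finally show ?case by (simp add: J_left)
  qed (use init in simp)
  show thesis
  proof (rule that[of N "\<lambda>t \<omega>. \<omega> t"])
    show "markov_chain N UNIV (\<lambda>_. S) (\<lambda>t \<omega>. \<omega> t)"
      by (rule markov_chainI_one_step[OF N S Y trans])
    show "\<forall>t. \<forall>u\<in>S. \<forall>v\<in>S.
        \<P>(\<omega> in N. \<omega> t = u \<and> \<omega> (Suc t) = v) = \<P>(\<omega> in M. A t \<omega> = u \<and> A (Suc t) \<omega> = v)"
      using pair_step law m_k by (simp add: measure_def J_def)
  qed
qed

section \<open>Alternations and the condition on an edge\<close>

lemma marginal_eq_of_pair_laws:
  assumes M: "prob_space M" and N: "prob_space N" and S: "countable S"
    and A: "A \<in> M \<rightarrow>\<^sub>M count_space S" "A' \<in> M \<rightarrow>\<^sub>M count_space S"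
    and B: "B \<in> N \<rightarrow>\<^sub>M count_space S" "B' \<in> N \<rightarrow>\<^sub>M count_space S"
    and pair: "\<And>v. v \<in> S \<Longrightarrow> \<P>(\<omega> in N. B \<omega> = u \<and> B' \<omega> = v) = \<P>(\<omega> in M. A \<omega> = u \<and> A' \<omega> = v)"
  shows "\<P>(\<omega> in N. B \<omega> = u) = \<P>(\<omega> in M. A \<omega> = u)"
proof -
  interpret M: prob_space M by (rule M)
  interpret N: prob_space N by (rule N)
  have "emeasure N {\<omega> \<in> space N. B \<omega> = u}
      = (\<integral>\<^sup>+v. emeasure N {\<omega> \<in> space N. B \<omega> = u \<and> B' \<omega> = v} \<partial>count_space S)"
    by (rule emeasure_partition_by_countable[OF S B(2)])
      (use sets_eq_values[of "{()}" "\<lambda>_. B" N "\<lambda>_. S" "\<lambda>_. u"] B in simp)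
  also have "\<dots> = (\<integral>\<^sup>+v. emeasure M {\<omega> \<in> space M. A \<omega> = u \<and> A' \<omega> = v} \<partial>count_space S)"
    by (rule nn_integral_cong) (simp add: pair M.emeasure_eq_measure N.emeasure_eq_measure)
  also have "\<dots> = emeasure M {\<omega> \<in> space M. A \<omega> = u}"
    by (rule emeasure_partition_by_countable[OF S A(2), symmetric])
      (use sets_eq_values[of "{()}" "\<lambda>_. A" M "\<lambda>_. S" "\<lambda>_. u"] A in simp)
  finally show ?thesis by (simp add: measure_def)
qed

text \<open>
  The condition that a rule \<open>K\<close> imposes on two adjacent variables of a chain. The chains of all three
  kinds are Markov chains subject to conditions of this form.
\<close>

definition flows_along :: "'a set \<Rightarrow> ('a \<Rightarrow> 'a \<Rightarrow> real) \<Rightarrow> 'b measure \<Rightarrow> ('b \<Rightarrow> 'a) \<Rightarrow> ('b \<Rightarrow> 'a) \<Rightarrow> bool" where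
  "flows_along S K M A B \<longleftrightarrow> (\<forall>u\<in>S. \<forall>v\<in>S.
     \<P>(\<omega> in M. A \<omega> = u \<and> B \<omega> = v) = \<P>(\<omega> in M. A \<omega> = u) * K u v)"

lemma measurable_level:
  assumes "markov_chain M I (level \<Omega> \<rho>) X" "i \<in> I"
  shows "X i \<in> M \<rightarrow>\<^sub>M count_space \<Omega>"
proof (rule measurable_compose[where N="count_space (level \<Omega> \<rho> i)" and g="\<lambda>x. x"])
  show "X i \<in> M \<rightarrow>\<^sub>M count_space (level \<Omega> \<rho> i)" using assms by (simp add: markov_chain_def)
qed (auto simp: level_def)

text \<open>
  The pair laws of an alternation are those of the sequence \<open>X\<^sub>i, X\<^sub>i\<^sub>+\<^sub>1, X\<^sub>i, X\<^sub>i\<^sub>+\<^sub>1, \<dots>\<close> taken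
  literally on the sample space of \<open>X\<close>.
\<close>

lemma alternation_exists:
  fixes \<Omega> :: "'a set"
  assumes "prob_space M" "countable \<Omega>"
    and "X i \<in> M \<rightarrow>\<^sub>M count_space \<Omega>" "X (i + 1) \<in> M \<rightarrow>\<^sub>M count_space \<Omega>"
  obtains N :: "(nat \<Rightarrow> 'a) measure" and Y where "alternation \<Omega> M X i N Y"
proof -
  let ?A = "\<lambda>t::nat. X (if even t then i else i + 1)"
  have A: "?A t \<in> M \<rightarrow>\<^sub>M count_space \<Omega>" for t using assms by simp
  obtain N :: "(nat \<Rightarrow> 'a) measure" and Y where mc: "markov_chain N UNIV (\<lambda>_. \<Omega>) Y"
    and pair: "\<forall>t. \<forall>u\<in>\<Omega>. \<forall>v\<in>\<Omega>.
      \<P>(\<omega> in N. Y t \<omega> = u \<and> Y (Suc t) \<omega> = v) = \<P>(\<omega> in M. ?A t \<omega> = u \<and> ?A (Suc t) \<omega> = v)"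
    using markov_chain_with_same_pair_laws[of M \<Omega> ?A, OF assms(1,2) A] .
  have "alternation \<Omega> M X i N Y" unfolding alternation_def by (simp add: mc pair)
  then show thesis by (rule that)
qed

lemma alternation_marginal:
  assumes alt: "alternation \<Omega> M X i N Y" and M: "prob_space M" and "countable \<Omega>"
    and X: "X i \<in> M \<rightarrow>\<^sub>M count_space \<Omega>" "X (i + 1) \<in> M \<rightarrow>\<^sub>M count_space \<Omega>"
    and "u \<in> \<Omega>"
  shows "\<P>(\<omega> in N. Y t \<omega> = u) = \<P>(\<omega> in M. X (if even t then i else i + 1) \<omega> = u)"
proof (rule marginal_eq_of_pair_laws[OF M _ \<open>countable \<Omega>\<close>])
  show "prob_space N" "Y t \<in> N \<rightarrow>\<^sub>M count_space \<Omega>" "Y (t + 1) \<in> N \<rightarrow>\<^sub>M count_space \<Omega>"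
    using alt by (auto simp: alternation_def markov_chain_def)
  show "X (if even t then i else i + 1) \<in> M \<rightarrow>\<^sub>M count_space \<Omega>"
    "X (if even t then i + 1 else i) \<in> M \<rightarrow>\<^sub>M count_space \<Omega>" using X by auto
  show "\<P>(\<omega> in N. Y t \<omega> = u \<and> Y (t + 1) \<omega> = v)
      = \<P>(\<omega> in M. X (if even t then i else i + 1) \<omega> = u \<and> X (if even t then i + 1 else i) \<omega> = v)"
    if "v \<in> \<Omega>" for v
    using alt[unfolded alternation_def, THEN conjunct2, THEN spec[of _ t], THEN bspec, OF \<open>u \<in> \<Omega>\<close>, THEN bspec, OF that]
    by simp
qed

text \<open>
  An alternation has the marginals and the pair laws of \<open>X\<close>, so being a \<open>UD\<close>-chain is a property
  of \<open>X\<^sub>i\<close> and \<open>X\<^sub>i\<^sub>+\<^sub>1\<close> and the same for all alternations. As there is an alternation, the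
  existential statement on the left amounts to that property.
\<close>

lemma alternation_is_UD_chain_iff:
  fixes \<Omega> :: "'a::order set"
  assumes M: "prob_space M" and \<Omega>: "countable \<Omega>"
    and X: "X i \<in> M \<rightarrow>\<^sub>M count_space \<Omega>" "X (i + 1) \<in> M \<rightarrow>\<^sub>M count_space \<Omega>"
  shows "alternation_is_UD_chain \<Omega> U D M X i \<longleftrightarrow>
    flows_along \<Omega> U M (X i) (X (i + 1)) \<and> flows_along \<Omega> D M (X (i + 1)) (X i)"
proof -
  have UD: "UD_chain \<Omega> U D N Y \<longleftrightarrow>
      flows_along \<Omega> U M (X i) (X (i + 1)) \<and> flows_along \<Omega> D M (X (i + 1)) (X i)" (is "_ \<longleftrightarrow> ?flows")
    if alt: "alternation \<Omega> M X i N Y" for N :: "(nat \<Rightarrow> 'a) measure" and Y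
  proof -
    note marg = alternation_marginal[OF alt M \<Omega> X]
    have mc: "markov_chain N UNIV (\<lambda>t. \<Omega>) Y" using alt by (simp add: alternation_def)
    have pair: "\<P>(\<omega> in N. Y t \<omega> = u \<and> Y (Suc t) \<omega> = v) =
        (if even t then \<P>(\<omega> in M. X i \<omega> = u \<and> X (i + 1) \<omega> = v)
         else \<P>(\<omega> in M. X (i + 1) \<omega> = u \<and> X i \<omega> = v))" if "u \<in> \<Omega>" "v \<in> \<Omega>" for t u v
      using alt that by (simp add: alternation_def)
    have "UD_chain \<Omega> U D N Y \<longleftrightarrow>
      (\<forall>t::nat. if even t then flows_along \<Omega> U M (X i) (X (i + 1)) else flows_along \<Omega> D M (X (i + 1)) (X i))"
      unfolding UD_chain_def flows_along_def using mc by (simp add: pair marg)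
    also have "\<dots> \<longleftrightarrow> ?flows"
      by (meson even_zero odd_one)
    finally show ?thesis .
  qed
  obtain N :: "(nat \<Rightarrow> 'a) measure" and Y where "alternation \<Omega> M X i N Y"
    using alternation_exists[OF M \<Omega> X] .
  with UD show ?thesis unfolding alternation_is_UD_chain_def by metis
qed

section \<open>The condition on all edges\<close>

text \<open>
  In an interval of the integers, the non-maximal elements \<open>i\<close> are the lower ends of the edges
  \<open>(i, i + 1)\<close>, and the non-minimal elements are the upper ends.
\<close>

lemma U_chain_D_chain_iff:
  assumes I: "int_interval I" and X: "markov_chain M I (level \<Omega> \<rho>) X"
  shows "U_chain I \<Omega> \<rho> U M X \<and> D_chain I \<Omega> \<rho> D M X \<longleftrightarrow>
    (\<forall>i. i \<in> I \<and> i + 1 \<in> I \<longrightarrow>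
      flows_along \<Omega> U M (X i) (X (i + 1)) \<and> flows_along \<Omega> D M (X (i + 1)) (X i))"
proof -
  have up: "nonmaximal I i \<longleftrightarrow> i \<in> I \<and> i + 1 \<in> I" for i
  proof
    assume "nonmaximal I i"
    then obtain j where "i \<in> I" "j \<in> I" "i < j" by (auto simp: nonmaximal_def)
    moreover from this have "{i..j} \<subseteq> I" using I by (simp add: int_interval_def)
    ultimately show "i \<in> I \<and> i + 1 \<in> I" by auto
  qed (auto simp: nonmaximal_def intro: bexI[of _ "i + 1"])
  have down: "nonminimal I i \<longleftrightarrow> i - 1 \<in> I \<and> i - 1 + 1 \<in> I" for i
  proof
    assume "nonminimal I i"
    then obtain j where "i \<in> I" "j \<in> I" "j < i" by (auto simp: nonminimal_def)
    moreover from this have "{j..i} \<subseteq> I" using I by (simp add: int_interval_def)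
    ultimately show "i - 1 \<in> I \<and> i - 1 + 1 \<in> I" by auto
  qed (auto simp: nonminimal_def intro: bexI[of _ "i - 1"])
  \<comment> \<open>The condition of a \<open>D\<close>-chain is indexed by the upper end of an edge; \<open>Q\<close> uses the lower end.\<close>
  define Q where "Q i \<longleftrightarrow> (i \<in> I \<and> i + 1 \<in> I \<longrightarrow> flows_along \<Omega> D M (X (i + 1)) (X i))" for i
  have "U_chain I \<Omega> \<rho> U M X \<longleftrightarrow> (\<forall>i. i \<in> I \<and> i + 1 \<in> I \<longrightarrow> flows_along \<Omega> U M (X i) (X (i + 1)))"
    using X by (simp add: U_chain_def flows_along_def up)
  moreover have "D_chain I \<Omega> \<rho> D M X \<longleftrightarrow> (\<forall>i. Q (i - 1))"
    using X by (simp add: D_chain_def flows_along_def down Q_def)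
  moreover have "(\<forall>i. Q (i - 1)) \<longleftrightarrow> (\<forall>i. Q i)"
    by (metis add_diff_cancel_right')
  ultimately show ?thesis unfolding Q_def by blast
qed

text \<open>
  The coordinates on the path space, under the law of \<open>X\<close>, have the same finite-dimensional laws as
  \<open>X\<close>. The Markov property and the conditions on the edges depend only on these.
\<close>

lemma strongly_compatibleI:
  fixes X :: "int \<Rightarrow> 'b \<Rightarrow> 'a::order"
  assumes I: "int_interval I" and U: "U_chain I \<Omega> \<rho> U M X" and D: "D_chain I \<Omega> \<rho> D M X"
  shows "strongly_compatible I \<Omega> \<rho> U D"
proof -
  have mc: "markov_chain M I (level \<Omega> \<rho>) X" using U by (simp add: U_chain_def)
  define L where "L = PiM I (\<lambda>i. count_space (level \<Omega> \<rho> i))"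
  define T where "T = (\<lambda>\<omega>. \<lambda>i\<in>I. X i \<omega>)"
  define N where "N = distr M L T"
  define Z where "Z = (\<lambda>(i::int) (w :: int \<Rightarrow> 'a). w i)"
  interpret prob_space M using mc by (simp add: markov_chain_def)
  have X: "X i \<in> M \<rightarrow>\<^sub>M count_space (level \<Omega> \<rho> i)" if "i \<in> I" for i
    using mc that by (simp add: markov_chain_def)
  have T: "T \<in> M \<rightarrow>\<^sub>M L" unfolding T_def L_def by (rule measurable_restrict) (rule X)
  have Z: "Z i \<in> N \<rightarrow>\<^sub>M count_space (level \<Omega> \<rho> i)" if "i \<in> I" for i
    using measurable_component_singleton[OF that] by (simp add: N_def L_def Z_def)
  have law: "\<P>(w in N. \<forall>r\<in>G. Z r w = x r) = \<P>(\<omega> in M. \<forall>r\<in>G. X r \<omega> = x r)"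
    if "finite G" "G \<subseteq> I" for G x
  proof -
    have "{w \<in> space N. \<forall>r\<in>G. Z r w = x r} \<in> sets N"
      by (rule sets_eq_values[where S="level \<Omega> \<rho>"]) (use Z that in auto)
    then have "{w \<in> space N. \<forall>r\<in>G. Z r w = x r} \<in> sets L" by (simp add: N_def)
    then have "\<P>(w in N. \<forall>r\<in>G. Z r w = x r) = prob (T -` {w \<in> space N. \<forall>r\<in>G. Z r w = x r} \<inter> space M)"
      unfolding N_def by (rule measure_distr[OF T])
    also have "T -` {w \<in> space N. \<forall>r\<in>G. Z r w = x r} \<inter> space M = {\<omega> \<in> space M. \<forall>r\<in>G. X r \<omega> = x r}"
      using that measurable_space[OF T] by (auto simp: N_def T_def Z_def subset_iff)
    finally show ?thesis .
  qed
  have law1: "\<P>(w in N. Z i w = u) = \<P>(\<omega> in M. X i \<omega> = u)" if "i \<in> I" for i u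
    using law[of "{i}" "\<lambda>_. u"] that by simp
  have law2: "\<P>(w in N. Z i w = u \<and> Z j w = v) = \<P>(\<omega> in M. X i \<omega> = u \<and> X j \<omega> = v)"
    if "i \<in> I" "j \<in> I" "i \<noteq> j" for i j u v
    using law[of "{i, j}" "\<lambda>r. if r = i then u else v"] that by simp
  have "markov_chain N I (level \<Omega> \<rho>) Z"
    unfolding markov_chain_def
  proof (intro conjI allI impI ballI)
    show "prob_space N" unfolding N_def by (rule prob_space_distr[OF T])
    show "Z t \<in> N \<rightarrow>\<^sub>M count_space (level \<Omega> \<rho> t)" if "t \<in> I" for t by (rule Z[OF that])
    fix F s t x
    assume "finite F \<and> F \<subseteq> I \<and> s \<in> F \<and> (\<forall>r\<in>F. r \<le> s) \<and> t \<in> I \<and> s < t \<and>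
      0 < \<P>(w in N. \<forall>r\<in>F. Z r w = x r)"
    then have F: "finite F" "F \<subseteq> I" "s \<in> F" "\<forall>r\<in>F. r \<le> s" "t \<in> I" "s < t"
      and pos: "0 < \<P>(w in N. \<forall>r\<in>F. Z r w = x r)" by simp_all
    have cond: "\<P>(w in N. Z t w = x t \<bar> \<forall>r\<in>G. Z r w = x r) = \<P>(\<omega> in M. X t \<omega> = x t \<bar> \<forall>r\<in>G. X r \<omega> = x r)"
      if "finite G" "G \<subseteq> I" for G
      using law[of "insert t G" x] law[of G x] that \<open>t \<in> I\<close> by (simp add: cond_prob_def)
    have "\<P>(\<omega> in M. X t \<omega> = x t \<bar> \<forall>r\<in>F. X r \<omega> = x r) = \<P>(\<omega> in M. X t \<omega> = x t \<bar> X s \<omega> = x s)"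
      using F pos law[of F x]
      by (intro mc[unfolded markov_chain_def, THEN conjunct2, THEN conjunct2, THEN spec[of _ F],
            THEN spec[of _ s], THEN spec[of _ t], THEN spec[of _ x], THEN mp]) simp
    then show "\<P>(w in N. Z t w = x t \<bar> \<forall>r\<in>F. Z r w = x r) = \<P>(w in N. Z t w = x t \<bar> Z s w = x s)"
      using cond[of F] cond[of "{s}"] F by auto
  qed
  note mc' = this
  have flows: "flows_along \<Omega> K N (Z i) (Z j) \<longleftrightarrow> flows_along \<Omega> K M (X i) (X j)"
    if "i \<in> I" "j \<in> I" "i \<noteq> j" for K i j
    using that by (simp add: flows_along_def law1 law2)
  have "U_chain I \<Omega> \<rho> U N Z \<and> D_chain I \<Omega> \<rho> D N Z"
    unfolding U_chain_D_chain_iff[OF I mc']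
    using U D U_chain_D_chain_iff[OF I mc, of U D] by (simp add: flows)
  then show ?thesis unfolding strongly_compatible_def by blast
qed

theorem theorem1:
  fixes I :: "int set" and \<Omega> :: "'a::order set" and \<rho> :: "'a \<Rightarrow> int"
    and U D :: "'a \<Rightarrow> 'a \<Rightarrow> real"
    and M :: "'b measure" and X :: "int \<Rightarrow> 'b \<Rightarrow> 'a"
  assumes "graded_poset I \<Omega> \<rho>"
    and "up_rule I \<Omega> \<rho> U"
    and "down_rule I \<Omega> \<rho> D"
    and "markov_chain M I (level \<Omega> \<rho>) X"
  shows "((U_chain I \<Omega> \<rho> U M X \<and> D_chain I \<Omega> \<rho> D M X) \<longleftrightarrow>
          (\<forall>i. i \<in> I \<and> i + 1 \<in> I \<longrightarrow> alternation_is_UD_chain \<Omega> U D M X i))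
       \<and> (U_chain I \<Omega> \<rho> U M X \<and> D_chain I \<Omega> \<rho> D M X \<longrightarrow> strongly_compatible I \<Omega> \<rho> U D)"
proof -
  have I: "int_interval I" and \<Omega>: "countable \<Omega>" using assms(1) by (simp_all add: graded_poset_def)
  have M: "prob_space M" using assms(4) by (simp add: markov_chain_def)
  have "alternation_is_UD_chain \<Omega> U D M X i \<longleftrightarrow>
      flows_along \<Omega> U M (X i) (X (i + 1)) \<and> flows_along \<Omega> D M (X (i + 1)) (X i)"
    if "i \<in> I" "i + 1 \<in> I" for i
    using that by (intro alternation_is_UD_chain_iff M \<Omega> measurable_level[OF assms(4)])
  then show ?thesis
    using U_chain_D_chain_iff[OF I assms(4)] strongly_compatibleI[OF I] by blast
qed

end
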